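(* Let $k,n\ge 1$ be integers. Then, as functions of the real variable $x$, $$\frac{d}{dx}c_k(n,x)=\frac{n}{2}\left(c_k(n-1,x)-c_{k-1}(n-1,x)\right).$$
   Context: For integers $n,k\ge 0$ and real $x$, the superoscillatory coefficients are $$c_k(n,x)=\binom{n}{k}\left(\frac{1+x}{2}\right)^{n-k}\left(\frac{1-x}{2}\right)^{k}\quad\text{if } k\le n,$$ and $c_k(n,x)=0$ if $k>n$. *)

theory Defs
  imports Complex_Main
begin

definition superosc_coeff :: "nat \<Rightarrow> nat \<Rightarrow> real \<Rightarrow> real" where
  "superosc_coeff k n x =
     (if k \<le> n then real (n choose k) * ((1 + x) / 2) ^ (n - k) * ((1 - x) / 2) ^ k else 0)"

end

theory Submission
  imports Defs
begin

text \<open>Put \<open>a = (1 + x) / 2\<close> and \<open>b = (1 - x) / 2\<close>, so that \<open>a' = 1/2\<close> and \<open>b' = -1/2\<close>. The product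
  rule splits the derivative of \<open>(n choose k) a^(n-k) b^k\<close> into a term with the factor
  \<open>(n - k) (n choose k) = n (n-1 choose k)\<close> and a term with the factor
  \<open>k (n choose k) = n (n-1 choose k-1)\<close>. These absorption identities turn the two terms into
  \<open>n/2\<close> times the coefficients of order \<open>n - 1\<close> with indices \<open>k\<close> and \<open>k - 1\<close>.\<close>

text \<open>Since \<open>n choose k\<close> vanishes for \<open>k > n\<close>, one formula covers both branches, and the
  differentiation below needs no case distinction.\<close>

lemma superosc_coeff_eq:
  "superosc_coeff k n x = real (n choose k) * ((1 + x) / 2) ^ (n - k) * ((1 - x) / 2) ^ k"
  by (simp add: superosc_coeff_def)

theorem lemma3p3:
  fixes k n :: nat and x :: real
  assumes "k \<ge> 1" and "n \<ge> 1"
  shows "((\<lambda>x. superosc_coeff k n x) has_real_derivative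
           (real n / 2) * (superosc_coeff k (n - 1) x - superosc_coeff (k - 1) (n - 1) x)) (at x)"
proof -
  define a b where "a = (1 + x) / 2" and "b = (1 - x) / 2"
  have upper: "real (n - k) * real (n choose k) = real n * real ((n - 1) choose k)"
    by (metis binomial_absorb_comp of_nat_mult)
  have lower: "real k * real (n choose k) = real n * real ((n - 1) choose (k - 1))"
    using assms(1) by (metis times_binomial_minus1_eq of_nat_mult less_eq_Suc_le One_nat_def)
  have exponents: "n - k - 1 = n - 1 - k" "n - k = n - 1 - (k - 1)"
    using assms by auto
  have "((\<lambda>x. superosc_coeff k n x) has_real_derivative
          real (n choose k) * (real (n - k) * a ^ (n - k - 1) * (1 / 2)) * b ^ k
          + real (n choose k) * a ^ (n - k) * (real k * b ^ (k - 1) * (- 1 / 2))) (at x)"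
    unfolding superosc_coeff_eq a_def b_def by (auto intro!: derivative_eq_intros simp: algebra_simps)
  also have "real (n choose k) * (real (n - k) * a ^ (n - k - 1) * (1 / 2)) * b ^ k
          + real (n choose k) * a ^ (n - k) * (real k * b ^ (k - 1) * (- 1 / 2))
        = (1 / 2) * ((real (n - k) * real (n choose k)) * a ^ (n - k - 1) * b ^ k
            - (real k * real (n choose k)) * a ^ (n - k) * b ^ (k - 1))"
    by (simp add: algebra_simps)
  also have "\<dots> = (real n / 2)
      * (superosc_coeff k (n - 1) x - superosc_coeff (k - 1) (n - 1) x)"
    unfolding upper lower
    unfolding exponents(1) unfolding exponents(2)
    unfolding superosc_coeff_eq a_def[symmetric] b_def[symmetric]
    by (simp add: algebra_simps)
  finally show ?thesis .
qed

end
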